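(* Let $\mathfrak g=\mathfrak g(t)\in\mathbb R\langle\mathbb T\rangle$ denote the solution to the Smoluchowski tree equation $$\partial_t\mathfrak g=\mathfrak g\vee\mathfrak g,\qquad \mathfrak g(0)=\bullet ,$$ where $\vee$ is the bilinear root-grafting product and $\bullet$ is the tree of grade $0$. Then $\mathfrak g$ is given by each of the following three equivalent expressions: $$\mathfrak g(t)=\sum_{\tau\in\mathbb T\setminus\{\emptyset\}}\frac{t^{|\tau|}}{|\tau|!}\,\omega(\tau)\cdot\tau\;\equiv\;\bigl(\exp(tB_\vee)\bigr)(\bullet)\;\equiv\;\bigl(\mathrm{id}-t\hat B_\vee\bigr)^{-1}(\bullet).$$ Further, with data $\mathfrak g(0)=\bullet$, $\mathfrak g=\mathfrak g(t)$ solves the linear equation $$\partial_t\mathfrak g=B_\vee(\mathfrak g).$$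
   Context: $\mathbb T$ is the set of rooted planar binary trees, including an empty tree $\emptyset$, which plays no role below: all trees considered are non-empty. The non-empty trees are generated as follows: $\bullet$ is a tree (it has no vertices and a single free end), and for any two non-empty trees $\tau_1,\tau_2$ there is a tree $\tau_1\vee\tau_2$ obtained by grafting $\tau_1$ (left) and $\tau_2$ (right) onto the two branches of a new root vertex. These trees correspond bijectively to the complete binary parenthesisations of a string of copies of one letter, with $\bullet$ corresponding to the single letter. The grade $|\tau|$ is the number of vertices, i.e. internal binary branchings, of $\tau$: $|\bullet|=0$ and $|\tau_1\vee\tau_2|=|\tau_1|+|\tau_2|+1$. A tree of grade $n$ has $n+1$ free ends (leaves). $\mathbb R\langle\mathbb T\rangle$ is the real algebra of (polynomials or) formal series $\sum_{\tau}c_\tau\cdot\tau$ with real coefficients over non-empty trees. Its product is the bilinear extension of grafting $(\tau_1,\tau_2)\mapsto\tau_1\vee\tau_2$ (non-commutative, non-associative). Infinite sums are understood formally (coefficientwise; there are finitely many trees of each grade), linear operators which raise the grade by one are applied termwise, and $\partial_t$ acts on coefficients. Weight character: $\omega(\bullet)=1$ and, recursively, $$\omega(\tau_1\vee\tau_2)=\binom{|\tau_1|+|\tau_2|}{|\tau_1|}\,\omega(\tau_1)\,\omega(\tau_2).$$ Branching operator: $B_\vee$ is the linear operator on $\mathbb R\langle\mathbb T\rangle$ such that, for a tree $\tau$, $B_\vee(\tau)$ is the sum, over all free ends of $\tau$, of the tree obtained from $\tau$ by attaching a single binary branching $\bullet\vee\bullet$ at that free end (replacing that leaf by $\bullet\vee\bullet$).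 E.g. $B_\vee(\bullet)=\bullet\vee\bullet$ and $B_\vee(\bullet\vee\bullet)=\bullet\vee(\bullet\vee\bullet)+(\bullet\vee\bullet)\vee\bullet$. Grade operator: $G$ is the linear operator with $G(\tau)=\frac{1}{|\tau|}\cdot\tau$ for trees $\tau$ of grade at least $1$, and $\hat B_\vee:=G\circ B_\vee$ (well defined since $B_\vee$ only produces trees of grade at least $1$). Finally $\exp(tB_\vee)=\sum_{n\geq0}\frac{t^n}{n!}B_\vee^n$, and $(\mathrm{id}-t\hat B_\vee)^{-1}$ is the inverse operator, $\sum_{n\ge0}t^n\hat B_\vee^n$. *)

theory Defs
  imports "HOL-Analysis.Analysis" "HOL-Library.Groups_Big_Fun"
begin

text \<open>Non-empty rooted planar binary trees. The empty tree is left out: it does not occur in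
  any of the notions below.\<close>

datatype tree = Leaf | Graft tree tree

primrec grade :: "tree \<Rightarrow> nat" where
  "grade Leaf = 0"
| "grade (Graft l r) = grade l + grade r + 1"

primrec omega :: "tree \<Rightarrow> nat" where
  "omega Leaf = 1"
| "omega (Graft l r) = ((grade l + grade r) choose grade l) * omega l * omega r"

text \<open>A formal series is identified with its family of coefficients.\<close>

type_synonym series = "tree \<Rightarrow> real"

definition single :: "tree \<Rightarrow> series" where
  "single \<tau> = (\<lambda>\<sigma>. if \<sigma> = \<tau> then 1 else 0)"

definition scale_series :: "real \<Rightarrow> series \<Rightarrow> series" where
  "scale_series c f = (\<lambda>\<sigma>. c * f \<sigma>)"

text \<open>A sum of a possibly infinite family of series, taken coefficientwise. It is meaningful
  if at every tree only finitely many members of the family have a non-zero coefficient; this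
  is the case for all the families used below (see the lemmas
  \<open>finite_support_graft\<close>, \<open>finite_support_B\<close>, \<open>finite_support_G\<close> and
  \<open>finite_support_powers\<close>; for multiples of distinct \<open>single \<tau>\<close> it is immediate).\<close>

definition formal_sum :: "('i \<Rightarrow> series) \<Rightarrow> series" where
  "formal_sum F = (\<lambda>\<sigma>. Sum_any (\<lambda>i. F i \<sigma>))"

definition linear_extension :: "(tree \<Rightarrow> series) \<Rightarrow> series \<Rightarrow> series" where
  "linear_extension L f = formal_sum (\<lambda>\<tau>. scale_series (f \<tau>) (L \<tau>))"

definition graft_prod :: "series \<Rightarrow> series \<Rightarrow> series"  (infixr "\<squnion>" 70) where
  "f \<squnion> g = formal_sum (\<lambda>(\<sigma>, \<tau>). scale_series (f \<sigma> * g \<tau>) (single (Graft \<sigma> \<tau>)))"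

text \<open>Free ends are addressed by the path from the root leading to them.\<close>

datatype branch = LeftBranch | RightBranch

primrec free_ends :: "tree \<Rightarrow> branch list set" where
  "free_ends Leaf = {[]}"
| "free_ends (Graft l r) = (#) LeftBranch ` free_ends l \<union> (#) RightBranch ` free_ends r"

text \<open>\<open>attach \<tau> p\<close> replaces the leaf at the free end \<open>p\<close> of \<open>\<tau>\<close> by a binary
  branching. It is only used with \<open>p \<in> free_ends \<tau>\<close>.\<close>

fun attach :: "tree \<Rightarrow> branch list \<Rightarrow> tree" where
  "attach Leaf p = Graft Leaf Leaf"
| "attach (Graft l r) (LeftBranch # p) = Graft (attach l p) r"
| "attach (Graft l r) (RightBranch # p) = Graft l (attach r p)"
| "attach (Graft l r) [] = Graft l r"

definition B_tree :: "tree \<Rightarrow> series" where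
  "B_tree \<tau> = (\<lambda>\<sigma>. \<Sum>p\<in>free_ends \<tau>. single (attach \<tau> p) \<sigma>)"

definition B_op :: "series \<Rightarrow> series" where
  "B_op = linear_extension B_tree"

text \<open>As \<open>1 / 0 = 0\<close>, this sends \<open>Leaf\<close> to the zero series. The value there is irrelevant,
  since \<open>Leaf\<close> has coefficient zero in the image of \<open>B_op\<close>.\<close>

definition G_op :: "series \<Rightarrow> series" where
  "G_op = linear_extension (\<lambda>\<tau>. scale_series (1 / real (grade \<tau>)) (single \<tau>))"

definition Bhat_op :: "series \<Rightarrow> series" where
  "Bhat_op = G_op \<circ> B_op"

definition exp_op :: "real \<Rightarrow> (series \<Rightarrow> series) \<Rightarrow> series \<Rightarrow> series" where
  "exp_op t A f = formal_sum (\<lambda>n. scale_series (t ^ n / fact n) ((A ^^ n) f))"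

text \<open>The operator inverse to \<open>\<lambda>f. f - t A f\<close>, as a Neumann series. That it is the two-sided
  inverse for \<open>A = Bhat_op\<close> is shown in the lemmas \<open>resolvent_right_inverse\<close>
  and \<open>resolvent_left_inverse\<close>.\<close>

definition resolvent :: "real \<Rightarrow> (series \<Rightarrow> series) \<Rightarrow> series \<Rightarrow> series" where
  "resolvent t A f = formal_sum (\<lambda>n. scale_series (t ^ n) ((A ^^ n) f))"

text \<open>\<open>g\<close> solves \<open>\<partial>\<^sub>t g = F(g)\<close>, \<open>g(0) = g0\<close> on the time interval \<open>S\<close>; the
  derivative acts on coefficients and is one-sided at end points belonging to \<open>S\<close>.\<close>

definition solves_on :: "real set \<Rightarrow> (series \<Rightarrow> series) \<Rightarrow> series \<Rightarrow> (real \<Rightarrow> series) \<Rightarrow> bool" where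
  "solves_on S F g0 g \<longleftrightarrow> g 0 = g0 \<and>
     (\<forall>t\<in>S. \<forall>\<tau>. ((\<lambda>s. g s \<tau>) has_real_derivative F (g t) \<tau>) (at t within S))"

subsection \<open>The formal sums are finite in each coefficient\<close>

lemma finite_grade_le: "finite {\<tau>. grade \<tau> \<le> n}"
proof (induction n)
  case 0
  have "{\<tau>. grade \<tau> \<le> 0} \<subseteq> {Leaf}"
  proof
    fix \<tau> assume "\<tau> \<in> {\<tau>. grade \<tau> \<le> 0}"
    then show "\<tau> \<in> {Leaf}" by (cases \<tau>) auto
  qed
  then show ?case by (rule finite_subset) simp
next
  case (Suc n)
  let ?A = "{\<tau>. grade \<tau> \<le> n}"
  have "{\<tau>. grade \<tau> \<le> Suc n} \<subseteq> insert Leaf ((\<lambda>(l, r). Graft l r) ` (?A \<times> ?A))"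
  proof
    fix \<tau> assume "\<tau> \<in> {\<tau>. grade \<tau> \<le> Suc n}"
    then show "\<tau> \<in> insert Leaf ((\<lambda>(l, r). Graft l r) ` (?A \<times> ?A))"
      by (cases \<tau>) (auto simp: image_iff)
  qed
  then show ?case by (rule finite_subset) (use Suc in auto)
qed

lemma finite_free_ends: "finite (free_ends \<tau>)"
  by (induction \<tau>) auto

lemma card_free_ends: "card (free_ends \<tau>) = grade \<tau> + 1"
proof (induction \<tau>)
  case (Graft l r)
  have "(#) LeftBranch ` free_ends l \<inter> (#) RightBranch ` free_ends r = {}"
    by auto
  then have "card (free_ends (Graft l r)) =
      card ((#) LeftBranch ` free_ends l) + card ((#) RightBranch ` free_ends r)"
    by (simp add: card_Un_disjoint finite_free_ends)
  also have "\<dots> = card (free_ends l) + card (free_ends r)"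
    by (simp add: card_image)
  finally show ?case using Graft by simp
qed simp

lemma grade_attach: "p \<in> free_ends \<tau> \<Longrightarrow> grade (attach \<tau> p) = grade \<tau> + 1"
  by (induction \<tau> arbitrary: p) auto

lemma B_tree_eq_0: "grade \<sigma> \<noteq> grade \<tau> + 1 \<Longrightarrow> B_tree \<tau> \<sigma> = 0"
  unfolding B_tree_def single_def by (intro sum.neutral) (auto simp: grade_attach)

lemma finite_support_graft:
  "finite {x. (case x of (\<sigma>, \<tau>) \<Rightarrow> scale_series (f \<sigma> * g \<tau>) (single (Graft \<sigma> \<tau>))) \<rho> \<noteq> 0}"
proof (cases \<rho>)
  case Leaf
  then show ?thesis by (simp add: single_def scale_series_def split_def)
next
  case (Graft l r)
  then have "{x. (case x of (\<sigma>, \<tau>) \<Rightarrow> scale_series (f \<sigma> * g \<tau>) (single (Graft \<sigma> \<tau>))) \<rho> \<noteq> 0} \<subseteq> {(l, r)}"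
    by (auto simp: single_def scale_series_def split: if_splits)
  then show ?thesis by (rule finite_subset) simp
qed

lemma finite_support_B: "finite {\<tau>. scale_series (f \<tau>) (B_tree \<tau>) \<sigma> \<noteq> 0}"
proof (rule finite_subset)
  show "{\<tau>. scale_series (f \<tau>) (B_tree \<tau>) \<sigma> \<noteq> 0} \<subseteq> {\<tau>. grade \<tau> \<le> grade \<sigma>}"
    unfolding scale_series_def using B_tree_eq_0 by force
qed (rule finite_grade_le)

lemma finite_support_G:
  "finite {\<tau>. scale_series (f \<tau>) (scale_series (1 / real (grade \<tau>)) (single \<tau>)) \<sigma> \<noteq> 0}"
  by (rule finite_subset[of _ "{\<sigma>}"]) (auto simp: scale_series_def single_def)

lemma B_op_finite: "B_op f \<sigma> = (\<Sum>\<tau> | grade \<tau> \<le> grade \<sigma>. f \<tau> * B_tree \<tau> \<sigma>)"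
proof -
  have "{\<tau>. scale_series (f \<tau>) (B_tree \<tau>) \<sigma> \<noteq> 0} \<subseteq> {\<tau>. grade \<tau> \<le> grade \<sigma>}"
    unfolding scale_series_def using B_tree_eq_0 by force
  then have "B_op f \<sigma> = (\<Sum>\<tau> | grade \<tau> \<le> grade \<sigma>. scale_series (f \<tau>) (B_tree \<tau>) \<sigma>)"
    unfolding B_op_def linear_extension_def formal_sum_def
    by (intro Sum_any.expand_superset finite_grade_le)
  then show ?thesis by (simp add: scale_series_def)
qed

lemma G_op_apply: "G_op f \<sigma> = f \<sigma> / real (grade \<sigma>)"
proof -
  have "{\<tau>. scale_series (f \<tau>) (scale_series (1 / real (grade \<tau>)) (single \<tau>)) \<sigma> \<noteq> 0} \<subseteq> {\<sigma>}"
    by (auto simp: scale_series_def single_def)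
  then have "G_op f \<sigma> = (\<Sum>\<tau>\<in>{\<sigma>}. scale_series (f \<tau>) (scale_series (1 / real (grade \<tau>)) (single \<tau>)) \<sigma>)"
    unfolding G_op_def linear_extension_def formal_sum_def
    by (intro Sum_any.expand_superset) auto
  then show ?thesis by (simp add: scale_series_def single_def)
qed

lemma graft_prod_Leaf: "(f \<squnion> g) Leaf = 0"
  by (simp add: graft_prod_def formal_sum_def single_def scale_series_def split_def)

lemma graft_prod_Graft: "(f \<squnion> g) (Graft l r) = f l * g r"
proof -
  let ?F = "\<lambda>x. (case x of (\<sigma>, \<tau>) \<Rightarrow> scale_series (f \<sigma> * g \<tau>) (single (Graft \<sigma> \<tau>))) (Graft l r)"
  have "{x. ?F x \<noteq> 0} \<subseteq> {(l, r)}"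
    by (auto simp: single_def scale_series_def split: if_splits)
  then have "(f \<squnion> g) (Graft l r) = (\<Sum>x\<in>{(l, r)}. ?F x)"
    unfolding graft_prod_def formal_sum_def by (intro Sum_any.expand_superset) auto
  then show ?thesis by (simp add: scale_series_def single_def)
qed

lemma B_op_Leaf: "B_op f Leaf = 0"
  by (simp add: B_op_finite B_tree_eq_0)

lemma B_op_power_eq_0: "grade \<sigma> < n \<Longrightarrow> (B_op ^^ n) f \<sigma> = 0"
proof (induction n arbitrary: \<sigma>)
  case (Suc n)
  have "(B_op ^^ n) f \<tau> * B_tree \<tau> \<sigma> = 0" for \<tau>
  proof (cases "grade \<sigma> = grade \<tau> + 1")
    case True
    with Suc show ?thesis by simp
  qed (simp add: B_tree_eq_0)
  then have "B_op ((B_op ^^ n) f) \<sigma> = 0"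
    unfolding B_op_finite[of "(B_op ^^ n) f"] by (intro sum.neutral) auto
  then show ?case by simp
qed simp

lemma Bhat_op_finite:
  "Bhat_op f \<sigma> = (\<Sum>\<tau> | grade \<tau> \<le> grade \<sigma>. f \<tau> * B_tree \<tau> \<sigma> / real (grade \<sigma>))"
  by (simp add: Bhat_op_def G_op_apply B_op_finite sum_divide_distrib)

lemma Bhat_op_power_eq_0: "grade \<sigma> < n \<Longrightarrow> (Bhat_op ^^ n) f \<sigma> = 0"
proof (induction n arbitrary: \<sigma>)
  case (Suc n)
  have "(Bhat_op ^^ n) f \<tau> * B_tree \<tau> \<sigma> = 0" for \<tau>
  proof (cases "grade \<sigma> = grade \<tau> + 1")
    case True
    with Suc show ?thesis by simp
  qed (simp add: B_tree_eq_0)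
  then have "Bhat_op ((Bhat_op ^^ n) f) \<sigma> = 0"
    unfolding Bhat_op_finite[of "(Bhat_op ^^ n) f"] by (intro sum.neutral) auto
  then show ?case by simp
qed simp

lemma support_powers:
  "{n. scale_series (c n) ((B_op ^^ n) f) \<sigma> \<noteq> 0} \<subseteq> {..grade \<sigma>}"
  "{n. scale_series (c n) ((Bhat_op ^^ n) f) \<sigma> \<noteq> 0} \<subseteq> {..grade \<sigma>}"
  unfolding scale_series_def
  using B_op_power_eq_0[of \<sigma> _ f] Bhat_op_power_eq_0[of \<sigma> _ f] linorder_not_le by auto

lemma finite_support_powers:
  "finite {n. scale_series (c n) ((B_op ^^ n) f) \<sigma> \<noteq> 0}"
  "finite {n. scale_series (c n) ((Bhat_op ^^ n) f) \<sigma> \<noteq> 0}"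
  by (rule finite_subset[OF support_powers(1)] finite_subset[OF support_powers(2)], simp)+

subsection \<open>The Neumann series is the inverse operator\<close>

lemma resolvent_finite:
  assumes "grade \<sigma> \<le> N"
  shows "resolvent t Bhat_op f \<sigma> = (\<Sum>n\<le>N. t ^ n * (Bhat_op ^^ n) f \<sigma>)"
proof -
  have "{n. scale_series (t ^ n) ((Bhat_op ^^ n) f) \<sigma> \<noteq> 0} \<subseteq> {..N}"
    using support_powers(2)[of "\<lambda>n. t ^ n" f \<sigma>] assms by force
  then have "resolvent t Bhat_op f \<sigma> = (\<Sum>n\<le>N. scale_series (t ^ n) ((Bhat_op ^^ n) f) \<sigma>)"
    unfolding resolvent_def formal_sum_def by (intro Sum_any.expand_superset) auto
  then show ?thesis by (simp add: scale_series_def)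
qed

lemma Bhat_op_diff_scale:
  "Bhat_op (\<lambda>\<sigma>. f \<sigma> - t * g \<sigma>) = (\<lambda>\<sigma>. Bhat_op f \<sigma> - t * Bhat_op g \<sigma>)"
proof
  fix \<sigma>
  show "Bhat_op (\<lambda>\<sigma>. f \<sigma> - t * g \<sigma>) \<sigma> = Bhat_op f \<sigma> - t * Bhat_op g \<sigma>"
    unfolding Bhat_op_finite sum_distrib_left sum_subtractf[symmetric]
    by (intro sum.cong) (simp_all add: left_diff_distrib diff_divide_distrib)
qed

lemma Bhat_op_power_diff_scale:
  "(Bhat_op ^^ n) (\<lambda>\<sigma>. f \<sigma> - t * g \<sigma>) = (\<lambda>\<sigma>. (Bhat_op ^^ n) f \<sigma> - t * (Bhat_op ^^ n) g \<sigma>)"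
  by (induction n) (simp_all add: Bhat_op_diff_scale)

lemma telescope:
  fixes a :: "nat \<Rightarrow> real"
  assumes "a (Suc N) = 0"
  shows "(\<Sum>n\<le>N. t ^ n * a n) - t * (\<Sum>n\<le>N. t ^ n * a (Suc n)) = a 0"
proof -
  have "(\<Sum>n\<le>N. t ^ n * a n) - t * (\<Sum>n\<le>N. t ^ n * a (Suc n)) = a 0 - t ^ Suc N * a (Suc N)"
    by (induction N) (simp_all add: algebra_simps)
  then show ?thesis using assms by simp
qed

lemma resolvent_right_inverse:
  "(\<lambda>\<sigma>. resolvent t Bhat_op f \<sigma> - t * Bhat_op (resolvent t Bhat_op f) \<sigma>) = f"
proof
  fix \<sigma>
  have "Bhat_op (resolvent t Bhat_op f) \<sigma> =
      (\<Sum>\<tau> | grade \<tau> \<le> grade \<sigma>. \<Sum>n\<le>grade \<sigma>.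
         t ^ n * ((Bhat_op ^^ n) f \<tau> * B_tree \<tau> \<sigma> / real (grade \<sigma>)))"
    unfolding Bhat_op_finite[of "resolvent t Bhat_op f"]
    by (intro sum.cong refl)
      (simp add: resolvent_finite[of _ "grade \<sigma>"] sum_distrib_right sum_divide_distrib mult.assoc)
  also have "\<dots> = (\<Sum>n\<le>grade \<sigma>. t ^ n * Bhat_op ((Bhat_op ^^ n) f) \<sigma>)"
    by (subst sum.swap) (simp only: Bhat_op_finite[of "(Bhat_op ^^ _) f"] sum_distrib_left)
  finally have *: "Bhat_op (resolvent t Bhat_op f) \<sigma> =
      (\<Sum>n\<le>grade \<sigma>. t ^ n * (Bhat_op ^^ Suc n) f \<sigma>)"
    by simp
  have "(Bhat_op ^^ Suc (grade \<sigma>)) f \<sigma> = 0"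
    by (rule Bhat_op_power_eq_0) simp
  from telescope[of "\<lambda>n. (Bhat_op ^^ n) f \<sigma>", OF this, of t]
  show "resolvent t Bhat_op f \<sigma> - t * Bhat_op (resolvent t Bhat_op f) \<sigma> = f \<sigma>"
    unfolding * resolvent_finite[OF order_refl] by simp
qed

lemma resolvent_left_inverse:
  "resolvent t Bhat_op (\<lambda>\<sigma>. f \<sigma> - t * Bhat_op f \<sigma>) = f"
proof
  fix \<sigma>
  have "(Bhat_op ^^ n) (Bhat_op f) = (Bhat_op ^^ Suc n) f" for n
    by (simp add: funpow_swap1)
  then have "resolvent t Bhat_op (\<lambda>\<sigma>. f \<sigma> - t * Bhat_op f \<sigma>) \<sigma> =
      (\<Sum>n\<le>grade \<sigma>. t ^ n * ((Bhat_op ^^ n) f \<sigma> - t * (Bhat_op ^^ Suc n) f \<sigma>))"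
    by (simp add: resolvent_finite[of \<sigma> "grade \<sigma>"] Bhat_op_power_diff_scale)
  also have "\<dots> = (\<Sum>n\<le>grade \<sigma>. t ^ n * (Bhat_op ^^ n) f \<sigma>)
      - t * (\<Sum>n\<le>grade \<sigma>. t ^ n * (Bhat_op ^^ Suc n) f \<sigma>)"
    by (simp add: right_diff_distrib sum_subtractf sum_distrib_left mult.left_commute
        del: funpow.simps)
  also have "\<dots> = (Bhat_op ^^ 0) f \<sigma>"
    by (rule telescope) (rule Bhat_op_power_eq_0, simp)
  finally show "resolvent t Bhat_op (\<lambda>\<sigma>. f \<sigma> - t * Bhat_op f \<sigma>) \<sigma> = f \<sigma>"
    by simp
qed

end

theory Submission imports Defs begin

text \<open>
  Why the theorem holds. Read \<open>\<omega>(\<tau>)\<close> as the number of ways to grow \<open>\<tau>\<close> from a single leaf by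
  branching one free end at a time, that is, the number of orderings of the vertices of \<open>\<tau>\<close> in
  which parents precede their children: for \<open>\<sigma> \<or> \<tau>\<close> the root comes first and the orderings of
  the two subtrees are shuffled, which is the recursion for \<open>\<omega>\<close>. Since one more step of growth
  is one application of \<open>B\<^sub>\<or>\<close>, this operator should map the part of grade \<open>n\<close> of
  \<open>\<Sum> \<omega>(\<tau>) \<cdot> \<tau>\<close> to the part of grade \<open>n + 1\<close>. This is lemma \<open>B_op_omega\<close>. It is proved by
  recursion on trees: growth of \<open>l \<or> r\<close> happens either in \<open>l\<close> or in \<open>r\<close>, so \<open>B\<^sub>\<or>\<close> obeys a
  Leibniz rule for grafting (\<open>B_op_Graft\<close>), and on the weights this rule is Pascal's identity.

  Everything else is bookkeeping by grade. Iterating \<open>B_op_omega\<close> shows that \<open>B\<^sub>\<or>\<^sup>n(\<bullet>)\<close> is the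
  part of grade \<open>n\<close> of \<open>\<Sum> \<omega>(\<tau>) \<cdot> \<tau>\<close>, and that \<open>G\<close> supplies a factor \<open>1/n!\<close> in the powers
  of the normalised operator; hence the exponential and the resolvent both give the explicit
  series (\<open>growth_series\<close>). For that series \<open>g \<or> g\<close> and \<open>B\<^sub>\<or>(g)\<close> both equal
  the derivative in time, so the quadratic and the linear equation agree along it. Finally, the
  quadratic equation is triangular: the coefficient at \<open>l \<or> r\<close> is an integral of the product of
  those at \<open>l\<close> and \<open>r\<close>, so by structural induction its solution is unique on every
  interval containing the initial time.
\<close>

section \<open>Leibniz rule for the branching operator\<close>

lemma B_tree_Leaf: "B_tree Leaf = single (Graft Leaf Leaf)"
  by (simp add: B_tree_def)

lemma B_tree_Graft:
  "B_tree (Graft a b) (Graft l r) = B_tree a l * single b r + single a l * B_tree b r"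
proof -
  have "B_tree (Graft a b) (Graft l r) =
      (\<Sum>p\<in>(#) LeftBranch ` free_ends a. single (attach (Graft a b) p) (Graft l r)) +
      (\<Sum>p\<in>(#) RightBranch ` free_ends b. single (attach (Graft a b) p) (Graft l r))"
    unfolding B_tree_def free_ends.simps
    by (rule sum.union_disjoint) (auto simp: finite_free_ends)
  also have "\<dots> = (\<Sum>p\<in>free_ends a. single (attach a p) l * single b r) +
      (\<Sum>p\<in>free_ends b. single a l * single (attach b p) r)"
    by (auto simp: sum.reindex single_def intro!: arg_cong2[where f = "(+)"] sum.cong)
  finally show ?thesis
    by (simp add: B_tree_def sum_distrib_left sum_distrib_right)
qed

lemma B_op_superset:
  assumes "finite A" "{\<tau>. grade \<tau> < grade \<sigma>} \<subseteq> A"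
  shows "B_op f \<sigma> = (\<Sum>\<tau>\<in>A. f \<tau> * B_tree \<tau> \<sigma>)"
  unfolding B_op_finite
proof (rule sum.mono_neutral_cong)
  show "f \<tau> * B_tree \<tau> \<sigma> = 0" if "\<tau> \<in> A - {\<tau>. grade \<tau> \<le> grade \<sigma>}" for \<tau>
    using that by (simp add: B_tree_eq_0)
  show "f \<tau> * B_tree \<tau> \<sigma> = 0" if "\<tau> \<in> {\<tau>. grade \<tau> \<le> grade \<sigma>} - A" for \<tau>
  proof -
    have "\<not> grade \<tau> < grade \<sigma>" using that assms(2) by blast
    then show ?thesis by (simp add: B_tree_eq_0)
  qed
qed (simp_all add: assms(1) finite_grade_le)

text \<open>A tree \<open>l \<or> r\<close> other than \<open>\<bullet> \<or> \<bullet>\<close> is obtained from \<open>a \<or> b\<close> by branching in the left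
  subtree, with \<open>b = r\<close>, or in the right subtree, with \<open>a = l\<close>. The root itself can only
  arise by branching the single leaf, which is the first summand.\<close>

lemma B_op_Graft:
  "B_op f (Graft l r) = f Leaf * single (Graft Leaf Leaf) (Graft l r)
     + B_op (\<lambda>a. f (Graft a r)) l + B_op (\<lambda>b. f (Graft l b)) r"
proof -
  define A where "A = {\<tau>. grade \<tau> \<le> grade l + grade r}"
  have fin: "finite A" and in_A: "l \<in> A" "r \<in> A"
    by (simp_all add: A_def finite_grade_le)
  have "\<tau> \<in> insert Leaf (case_prod Graft ` (A \<times> A))" if "grade \<tau> < grade (Graft l r)" for \<tau>
    using that by (cases \<tau>) (auto simp: A_def image_iff)
  then have "B_op f (Graft l r) =
      (\<Sum>\<tau>\<in>insert Leaf (case_prod Graft ` (A \<times> A)). f \<tau> * B_tree \<tau> (Graft l r))"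
    using fin by (intro B_op_superset) auto
  also have "\<dots> = f Leaf * B_tree Leaf (Graft l r)
      + (\<Sum>\<tau>\<in>case_prod Graft ` (A \<times> A). f \<tau> * B_tree \<tau> (Graft l r))"
    using fin by (subst sum.insert) auto
  also have "(\<Sum>\<tau>\<in>case_prod Graft ` (A \<times> A). f \<tau> * B_tree \<tau> (Graft l r)) =
      (\<Sum>a\<in>A. \<Sum>b\<in>A. f (Graft a b) * B_tree (Graft a b) (Graft l r))"
    by (subst sum.reindex) (auto simp: inj_on_def sum.cartesian_product split_def)
  also have "\<dots> = (\<Sum>a\<in>A. \<Sum>b\<in>A. f (Graft a b) * B_tree a l * single b r)
      + (\<Sum>a\<in>A. \<Sum>b\<in>A. f (Graft a b) * B_tree b r * single a l)"
    by (simp add: B_tree_Graft sum.distrib algebra_simps)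
  also have "(\<Sum>a\<in>A. \<Sum>b\<in>A. f (Graft a b) * B_tree a l * single b r) =
      (\<Sum>a\<in>A. f (Graft a r) * B_tree a l)"
    using fin in_A by (simp add: single_def if_distrib[of "(*) _"] cong: if_cong)
  also have "\<dots> = B_op (\<lambda>a. f (Graft a r)) l"
    using fin by (intro B_op_superset[symmetric]) (auto simp: A_def)
  also have "(\<Sum>a\<in>A. \<Sum>b\<in>A. f (Graft a b) * B_tree b r * single a l) =
      (\<Sum>b\<in>A. f (Graft l b) * B_tree b r)"
    using fin in_A
    by (subst sum.swap) (simp add: single_def if_distrib[of "(*) _"] cong: if_cong)
  also have "\<dots> = B_op (\<lambda>b. f (Graft l b)) r"
    using fin by (intro B_op_superset[symmetric]) (auto simp: A_def)
  finally show ?thesis by (simp add: B_tree_Leaf)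
qed

text \<open>Since branching raises the grade by exactly one, factors depending on the grade only can
  be pulled out. This lets one treat all grades at once instead of splitting a series into its
  homogeneous parts.\<close>

lemma B_op_graded: "B_op (\<lambda>\<tau>. c (grade \<tau>) * f \<tau>) \<sigma> = c (grade \<sigma> - 1) * B_op f \<sigma>"
  unfolding B_op_finite sum_distrib_left
proof (rule sum.cong)
  fix \<tau>
  show "c (grade \<tau>) * f \<tau> * B_tree \<tau> \<sigma> = c (grade \<sigma> - 1) * (f \<tau> * B_tree \<tau> \<sigma>)"
    by (cases "grade \<sigma> = grade \<tau> + 1") (simp_all add: B_tree_eq_0)
qed simp

section \<open>The weights are reproduced by branching\<close>

text \<open>Among the \<open>(|l| + |r|) choose |l|\<close> shuffles, those whose last step is in \<open>l\<close> number
  \<open>(|l| + |r| - 1) choose (|l| - 1)\<close>, those whose last step is in \<open>r\<close> number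
  \<open>(|l| + |r| - 1) choose |l|\<close>. The truncated subtraction is harmless at a leaf, because there
  the image of \<open>B_op\<close> has coefficient zero.\<close>

lemma B_op_omega:
  "B_op (\<lambda>\<tau>. real (omega \<tau>)) \<sigma> = (if \<sigma> = Leaf then 0 else real (omega \<sigma>))"
proof (induction \<sigma>)
  case Leaf
  then show ?case by (simp add: B_op_Leaf)
next
  case (Graft l r)
  have left: "B_op (\<lambda>a. real (omega (Graft a r))) l =
      real ((grade l - 1 + grade r) choose (grade l - 1)) * real (omega r)
        * B_op (\<lambda>\<tau>. real (omega \<tau>)) l"
    using B_op_graded[of "\<lambda>n. real ((n + grade r) choose n) * real (omega r)"
        "\<lambda>\<tau>. real (omega \<tau>)" l]
    by (simp add: mult_ac)
  have right: "B_op (\<lambda>b. real (omega (Graft l b))) r =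
      real ((grade l + (grade r - 1)) choose grade l) * real (omega l)
        * B_op (\<lambda>\<tau>. real (omega \<tau>)) r"
    using B_op_graded[of "\<lambda>n. real ((grade l + n) choose grade l) * real (omega l)"
        "\<lambda>\<tau>. real (omega \<tau>)" r]
    by (simp add: mult_ac)
  show ?case
    unfolding B_op_Graft left right Graft
    \<comment> \<open>Pascal's identity when both subtrees have positive grade; if both are leaves, the weight
      comes from branching the single leaf\<close>
    by (cases l; cases r) (simp_all add: single_def algebra_simps)
qed

section \<open>The growth series\<close>

definition growth_series :: "real \<Rightarrow> series" where
  "growth_series t = (\<lambda>\<tau>. t ^ grade \<tau> / fact (grade \<tau>) * real (omega \<tau>))"

lemma formal_sum_single: "formal_sum (\<lambda>\<tau>. scale_series (f \<tau>) (single \<tau>)) = f"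
proof
  fix \<sigma>
  have "formal_sum (\<lambda>\<tau>. scale_series (f \<tau>) (single \<tau>)) \<sigma> =
      (\<Sum>\<tau>\<in>{\<sigma>}. scale_series (f \<tau>) (single \<tau>) \<sigma>)"
    unfolding formal_sum_def
    by (rule Sum_any.expand_superset) (auto simp: scale_series_def single_def)
  then show "formal_sum (\<lambda>\<tau>. scale_series (f \<tau>) (single \<tau>)) \<sigma> = f \<sigma>"
    by (simp add: scale_series_def single_def)
qed

lemma single_Leaf: "single Leaf = (\<lambda>\<sigma>. if grade \<sigma> = 0 then real (omega \<sigma>) else 0)"
proof
  show "single Leaf \<sigma> = (if grade \<sigma> = 0 then real (omega \<sigma>) else 0)" for \<sigma>
    by (cases \<sigma>) (simp_all add: single_def)
qed

lemma B_op_graded_omega: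
  "B_op (\<lambda>\<tau>. if grade \<tau> = n then c * real (omega \<tau>) else 0) \<sigma> =
    (if grade \<sigma> = Suc n then c * real (omega \<sigma>) else 0)"
proof -
  have "B_op (\<lambda>\<tau>. if grade \<tau> = n then c * real (omega \<tau>) else 0) \<sigma> =
      B_op (\<lambda>\<tau>. (if grade \<tau> = n then c else 0) * real (omega \<tau>)) \<sigma>"
    by (rule arg_cong[of _ _ "\<lambda>f. B_op f \<sigma>"]) auto
  also have "\<dots> = (if grade \<sigma> - 1 = n then c else 0) * (if \<sigma> = Leaf then 0 else real (omega \<sigma>))"
    using B_op_graded[of "\<lambda>m. if m = n then c else 0" "\<lambda>\<tau>. real (omega \<tau>)" \<sigma>]
    by (simp only: B_op_omega)
  finally show ?thesis by (cases \<sigma>) auto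
qed

lemma B_op_power_Leaf:
  "(B_op ^^ n) (single Leaf) = (\<lambda>\<sigma>. if grade \<sigma> = n then real (omega \<sigma>) else 0)"
proof (induction n)
  case (Suc n)
  have "(B_op ^^ Suc n) (single Leaf) \<sigma> = (if grade \<sigma> = Suc n then real (omega \<sigma>) else 0)" for \<sigma>
    using B_op_graded_omega[of n 1 \<sigma>] by (simp add: Suc cong: if_cong)
  then show ?case by blast
qed (simp add: single_Leaf)

lemma Bhat_op_power_Leaf:
  "(Bhat_op ^^ n) (single Leaf) =
    (\<lambda>\<sigma>. if grade \<sigma> = n then inverse (fact n) * real (omega \<sigma>) else 0)"
proof (induction n)
  case (Suc n)
  then show ?case
    by (auto simp: Bhat_op_def G_op_apply B_op_graded_omega field_simps)
qed (auto simp: single_Leaf)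

lemma exp_B_op_Leaf: "exp_op t B_op (single Leaf) = growth_series t"
proof
  fix \<sigma>
  have "exp_op t B_op (single Leaf) \<sigma> =
      (\<Sum>n\<in>{grade \<sigma>}. scale_series (t ^ n / fact n) ((B_op ^^ n) (single Leaf)) \<sigma>)"
    unfolding exp_op_def formal_sum_def
    by (rule Sum_any.expand_superset) (auto simp: scale_series_def B_op_power_Leaf)
  then show "exp_op t B_op (single Leaf) \<sigma> = growth_series t \<sigma>"
    by (simp add: scale_series_def B_op_power_Leaf growth_series_def)
qed

lemma resolvent_Bhat_op_Leaf: "resolvent t Bhat_op (single Leaf) = growth_series t"
proof
  fix \<sigma>
  have "resolvent t Bhat_op (single Leaf) \<sigma> =
      (\<Sum>n\<in>{grade \<sigma>}. scale_series (t ^ n) ((Bhat_op ^^ n) (single Leaf)) \<sigma>)"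
    unfolding resolvent_def formal_sum_def
    by (rule Sum_any.expand_superset) (auto simp: scale_series_def Bhat_op_power_Leaf)
  then show "resolvent t Bhat_op (single Leaf) \<sigma> = growth_series t \<sigma>"
    by (simp add: scale_series_def Bhat_op_power_Leaf growth_series_def field_simps)
qed

section \<open>The two differential equations\<close>

text \<open>The binomial coefficient in \<open>\<omega>\<close> turns \<open>t\<^sup>n / n!\<close> into the product of the corresponding
  divided powers of the two subtrees.\<close>

lemma growth_series_square_Graft:
  "(growth_series t \<squnion> growth_series t) (Graft l r) =
    t ^ (grade l + grade r) / fact (grade l + grade r) * real (omega (Graft l r))"
  by (simp add: graft_prod_Graft growth_series_def binomial_fact power_add)

lemma growth_series_square_eq_B_op:
  "growth_series t \<squnion> growth_series t = B_op (growth_series t)"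
proof
  fix \<sigma>
  show "(growth_series t \<squnion> growth_series t) \<sigma> = B_op (growth_series t) \<sigma>"
  proof (cases \<sigma>)
    case Leaf
    then show ?thesis by (simp add: graft_prod_Leaf B_op_Leaf)
  next
    case (Graft l r)
    then show ?thesis
      using B_op_graded[of "\<lambda>n. t ^ n / fact n" "\<lambda>\<tau>. real (omega \<tau>)" \<sigma>]
      unfolding growth_series_def[symmetric]
      by (simp add: growth_series_square_Graft B_op_omega del: omega.simps)
  qed
qed

lemma growth_series_has_derivative:
  "((\<lambda>s. growth_series s \<sigma>) has_real_derivative (growth_series t \<squnion> growth_series t) \<sigma>)
    (at t within S)"
proof (cases \<sigma>)
  case Leaf
  then show ?thesis by (simp add: growth_series_def graft_prod_Leaf)
next
  case (Graft l r)
  let ?n = "grade l + grade r"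
  have "((\<lambda>s. s ^ Suc ?n / fact (Suc ?n) * real (omega \<sigma>)) has_real_derivative
      real (Suc ?n) * t ^ ?n / fact (Suc ?n) * real (omega \<sigma>)) (at t within S)"
    using DERIV_cmult_right[OF DERIV_cdivide[OF DERIV_pow[of "Suc ?n" t S]],
        of "fact (Suc ?n)" "real (omega \<sigma>)"]
    by (simp only: diff_Suc_Suc diff_zero)
  also have "real (Suc ?n) * t ^ ?n / fact (Suc ?n) * real (omega \<sigma>) =
      t ^ ?n / fact ?n * real (omega \<sigma>)"
    by (simp del: of_nat_Suc)
  finally show ?thesis
    unfolding Graft growth_series_square_Graft by (simp add: growth_series_def)
qed

lemma growth_series_0: "growth_series 0 = single Leaf"
  by (auto simp: growth_series_def single_Leaf)

lemma growth_series_solves: "solves_on S (\<lambda>h. h \<squnion> h) (single Leaf) growth_series"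
  unfolding solves_on_def using growth_series_0 growth_series_has_derivative by blast

text \<open>The derivative of the coefficient at \<open>l \<or> r\<close> involves the coefficients at \<open>l\<close> and \<open>r\<close>
  only, so once these are known, both solutions have the same derivative there. On an interval
  they then differ by a constant, which vanishes at time zero.\<close>

lemma square_solution_unique:
  assumes "is_interval S" "0 \<in> S"
    and f: "solves_on S (\<lambda>h. h \<squnion> h) h0 f" and g: "solves_on S (\<lambda>h. h \<squnion> h) h0 g"
    and "t \<in> S"
  shows "f t = g t"
proof
  fix \<tau>
  have step: "\<forall>s\<in>S. f s \<tau> = g s \<tau>"
    if same: "\<And>s. s \<in> S \<Longrightarrow> (f s \<squnion> f s) \<tau> = (g s \<squnion> g s) \<tau>" for \<tau>
  proof -
    have "((\<lambda>s. f s \<tau> - g s \<tau>) has_real_derivative 0) (at s within S)" if "s \<in> S" for s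
      using f g same[OF that] that unfolding solves_on_def
      by (metis DERIV_diff diff_self)
    then obtain c where c: "\<And>s. s \<in> S \<Longrightarrow> f s \<tau> - g s \<tau> = c"
      using has_field_derivative_zero_constant[OF is_interval_convex[OF assms(1)],
          of "\<lambda>s. f s \<tau> - g s \<tau>"] by auto
    moreover have "f 0 \<tau> - g 0 \<tau> = 0"
      using f g by (simp add: solves_on_def)
    ultimately have "c = 0"
      using \<open>0 \<in> S\<close> by force
    with c show ?thesis by simp
  qed
  have "\<forall>s\<in>S. f s \<tau> = g s \<tau>"
    by (induction \<tau>) (rule step; simp add: graft_prod_Leaf graft_prod_Graft)+
  then show "f t \<tau> = g t \<tau>" using \<open>t \<in> S\<close> by blast
qed

theorem theorem3:
  fixes S :: "real set"
  assumes "is_interval S" and "0 \<in> S"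
  shows "(\<exists>g. solves_on S (\<lambda>h. h \<squnion> h) (single Leaf) g) \<and>
    (\<forall>g. solves_on S (\<lambda>h. h \<squnion> h) (single Leaf) g \<longrightarrow>
      (\<forall>t\<in>S.
         g t = formal_sum (\<lambda>\<tau>. scale_series (t ^ grade \<tau> / fact (grade \<tau>) * real (omega \<tau>)) (single \<tau>)) \<and>
         g t = exp_op t B_op (single Leaf) \<and>
         g t = resolvent t Bhat_op (single Leaf)) \<and>
      solves_on S B_op (single Leaf) g)"
proof (intro conjI allI impI)
  show "\<exists>g. solves_on S (\<lambda>h. h \<squnion> h) (single Leaf) g"
    using growth_series_solves by blast
next
  fix g assume g: "solves_on S (\<lambda>h. h \<squnion> h) (single Leaf) g"
  have eq: "g t = growth_series t" if "t \<in> S" for t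
    using square_solution_unique[OF assms g growth_series_solves that] .
  show "\<forall>t\<in>S.
      g t = formal_sum (\<lambda>\<tau>. scale_series (t ^ grade \<tau> / fact (grade \<tau>) * real (omega \<tau>)) (single \<tau>)) \<and>
      g t = exp_op t B_op (single Leaf) \<and>
      g t = resolvent t Bhat_op (single Leaf)"
    unfolding exp_B_op_Leaf resolvent_Bhat_op_Leaf formal_sum_single
    using eq by (auto simp: growth_series_def)
  show "solves_on S B_op (single Leaf) g"
    using g unfolding solves_on_def by (simp add: eq growth_series_square_eq_B_op)
qed

end
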